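(* Let $P=(V_1,\dots,V_n)$ be a polygon in the plane with nonzero signed area. If $P$ is equilateral, i.e. all its sides have equal lengths, then $CCM(P)=CM(P)$.
   Context: A polygon $P=(V_1,\dots,V_n)$, $n\ge 3$, is a closed oriented polygon in $\mathbb{R}^2$ given by the cyclic sequence of its vertices (indices mod $n$), consecutive vertices being distinct; self-intersections are allowed. With $V_i=(x_i,y_i)$ its signed area is $A(P)=\tfrac12\sum_i (x_iy_{i+1}-x_{i+1}y_i)$. If $A(P)\ne0$, the Circumcenter of Mass is $CCM(P)=\sum_i \frac{A_i}{A(P)}C_i$, where $O$ is any point not on the sides of $P$ or their extensions, $C_i$ is the circumcenter of the triangle $OV_iV_{i+1}$, and $A_i=\tfrac12\det(V_i-O,V_{i+1}-O)$ is its signed area; this does not depend on the choice of $O$. $CM(P)$ is the center of mass of $P$ (of the homogeneous lamina bounded by $P$), obtained by the same formula with the circumcenters replaced by the centroids of the triangles $OV_iV_{i+1}$; in coordinates, $$CM(P)=\frac{1}{6A(P)}\Big(\sum_i (x_i+x_{i+1})(x_iy_{i+1}-x_{i+1}y_i),\ \sum_i (y_i+y_{i+1})(x_iy_{i+1}-x_{i+1}y_i)\Big).$$ *)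

theory Defs
  imports "HOL-Analysis.Analysis"
begin

text \<open>
  A polygon is given by the list of its vertices; \<open>vertex P i\<close> reads the index modulo the
  number of vertices, so that \<open>vertex P (Suc i)\<close> is the cyclic successor of \<open>vertex P i\<close>.
\<close>

definition vertex :: "(real^2) list \<Rightarrow> nat \<Rightarrow> real^2" where
  "vertex P i = P ! (i mod length P)"

definition polygon :: "(real^2) list \<Rightarrow> bool" where
  "polygon P \<longleftrightarrow>
     length P \<ge> 3 \<and> (\<forall>i<length P. vertex P i \<noteq> vertex P (Suc i))"

definition equilateral :: "(real^2) list \<Rightarrow> bool" where
  "equilateral P \<longleftrightarrow>
     (\<forall>i<length P. \<forall>j<length P.
        dist (vertex P i) (vertex P (Suc i)) = dist (vertex P j) (vertex P (Suc j)))"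

definition signed_area :: "(real^2) list \<Rightarrow> real" where
  "signed_area P =
     (1/2) * (\<Sum>i<length P. vertex P i $ 1 * vertex P (Suc i) $ 2
                         - vertex P (Suc i) $ 1 * vertex P i $ 2)"

definition tri_area :: "real^2 \<Rightarrow> real^2 \<Rightarrow> real^2 \<Rightarrow> real" where
  "tri_area a b c = (1/2) * det (vector [b - a, c - a] :: real^2^2)"

text \<open>The point is unique when the triangle is nondegenerate: \<open>circumcenter_unique\<close> below.\<close>

definition circumcenter :: "real^2 \<Rightarrow> real^2 \<Rightarrow> real^2 \<Rightarrow> real^2" where
  "circumcenter a b c = (THE p. dist p a = dist p b \<and> dist p a = dist p c)"

definition centroid :: "real^2 \<Rightarrow> real^2 \<Rightarrow> real^2 \<Rightarrow> real^2" where
  "centroid a b c = (1/3) *\<^sub>R (a + b + c)"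

definition off_side_lines :: "(real^2) list \<Rightarrow> real^2 \<Rightarrow> bool" where
  "off_side_lines P q \<longleftrightarrow>
     (\<forall>i<length P. q \<notin> affine hull {vertex P i, vertex P (Suc i)})"

definition CCM_from :: "real^2 \<Rightarrow> (real^2) list \<Rightarrow> real^2" where
  "CCM_from q P =
     (\<Sum>i<length P. (tri_area q (vertex P i) (vertex P (Suc i)) / signed_area P)
        *\<^sub>R circumcenter q (vertex P i) (vertex P (Suc i)))"

text \<open>
  The common value of \<open>CCM_from q P\<close> over all admissible \<open>q\<close>. Such \<open>q\<close> exist
  (\<open>off_side_lines_exists\<close>) and all give the same value (\<open>CCM_eq_CCM_from\<close>).
\<close>

definition CCM :: "(real^2) list \<Rightarrow> real^2" where
  "CCM P = (THE z. \<forall>q. off_side_lines P q \<longrightarrow> CCM_from q P = z)"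

text \<open>
  Center of mass in coordinates; \<open>CM_eq_centroids\<close> below gives the decomposition into
  centroids of the triangles with apex \<open>q\<close>.
\<close>

definition CM :: "(real^2) list \<Rightarrow> real^2" where
  "CM P = (1 / (6 * signed_area P)) *\<^sub>R vector
     [\<Sum>i<length P. (vertex P i $ 1 + vertex P (Suc i) $ 1)
        * (vertex P i $ 1 * vertex P (Suc i) $ 2 - vertex P (Suc i) $ 1 * vertex P i $ 2),
      \<Sum>i<length P. (vertex P i $ 2 + vertex P (Suc i) $ 2)
        * (vertex P i $ 1 * vertex P (Suc i) $ 2 - vertex P (Suc i) $ 1 * vertex P i $ 2)]"

lemma tri_area_coords:
  "tri_area a b c =
     ((b$1 - a$1) * (c$2 - a$2) - (b$2 - a$2) * (c$1 - a$1)) / 2"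
  by (simp add: tri_area_def det_2 vector_2 algebra_simps)

lemma sum_cyclic:
  fixes g :: "real^2 \<Rightarrow> 'a::ab_group_add"
  assumes "P \<noteq> []"
  shows "(\<Sum>i<length P. g (vertex P (Suc i)) - g (vertex P i)) = 0"
  using assms sum_lessThan_telescope[of "\<lambda>i. g (vertex P i)" "length P"]
  by (simp add: vertex_def)

lemma tri_area_nonzero:
  assumes "b \<noteq> c" "q \<notin> affine hull {b, c}"
  shows "tri_area q b c \<noteq> 0"
proof
  assume "tri_area q b c = 0"
  then have z: "(b$1 - q$1) * (c$2 - q$2) = (b$2 - q$2) * (c$1 - q$1)"
    by (simp add: tri_area_coords)
  define d where "d = c - b"
  have d: "d$1 = c$1 - b$1" "d$2 = c$2 - b$2" by (simp_all add: d_def)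
  have z': "(q$1 - b$1) * d$2 = (q$2 - b$2) * d$1"
    using z unfolding d by algebra
  have "d \<noteq> 0" using assms by (simp add: d_def)
  then have nz: "d$1 \<noteq> 0 \<or> d$2 \<noteq> 0" by (auto simp: vec_eq_iff forall_2)
  obtain t where "q$1 - b$1 = t * d$1" "q$2 - b$2 = t * d$2"
  proof (cases "d$1 = 0")
    case True
    then show ?thesis using nz z' that[of "(q$2 - b$2) / d$2"] by auto
  next
    case False
    then show ?thesis using z' that[of "(q$1 - b$1) / d$1"] by (auto simp: field_simps)
  qed
  then have "q = (1 - t) *\<^sub>R b + t *\<^sub>R c"
    by (simp add: vec_eq_iff forall_2 d algebra_simps)
  then show False using assms(2) unfolding affine_hull_2 by force
qed

lemma dist_eq_coords:
  fixes p a b :: "real^2"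
  shows "dist p a = dist p b \<longleftrightarrow>
     (p$1 - a$1)\<^sup>2 + (p$2 - a$2)\<^sup>2 = (p$1 - b$1)\<^sup>2 + (p$2 - b$2)\<^sup>2"
  by (simp add: dist_vec_def L2_set_def sum_2 dist_real_def)

definition circ_num :: "real^2 \<Rightarrow> real^2 \<Rightarrow> real^2 \<Rightarrow> real^2" where
  "circ_num a b c = vector
     [((b$1 - a$1)\<^sup>2 + (b$2 - a$2)\<^sup>2) * (c$2 - a$2) - ((c$1 - a$1)\<^sup>2 + (c$2 - a$2)\<^sup>2) * (b$2 - a$2),
      ((c$1 - a$1)\<^sup>2 + (c$2 - a$2)\<^sup>2) * (b$1 - a$1) - ((b$1 - a$1)\<^sup>2 + (b$2 - a$2)\<^sup>2) * (c$1 - a$1)]"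

lemma equidistant_iff:
  assumes "tri_area a b c \<noteq> 0"
  shows "dist p a = dist p b \<and> dist p a = dist p c \<longleftrightarrow>
     p = a + (1 / (4 * tri_area a b c)) *\<^sub>R circ_num a b c" (is "?L \<longleftrightarrow> ?R")
proof -
  define D where "D = 4 * tri_area a b c"
  define u w x1 x2 y1 y2 where
    "u = p$1 - a$1" and "w = p$2 - a$2" and "x1 = b$1 - a$1" and "x2 = b$2 - a$2"
    and "y1 = c$1 - a$1" and "y2 = c$2 - a$2"
  have D: "D = 2 * (x1 * y2 - x2 * y1)"
    by (simp add: D_def tri_area_coords x1_def x2_def y1_def y2_def)
  have "D \<noteq> 0" using assms by (simp add: D_def)
  have sh: "p$1 - b$1 = u - x1" "p$2 - b$2 = w - x2" "p$1 - c$1 = u - y1" "p$2 - c$2 = w - y2"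
    by (simp_all add: u_def w_def x1_def x2_def y1_def y2_def)
  have L: "?L \<longleftrightarrow> 2*(u*x1 + w*x2) = x1\<^sup>2 + x2\<^sup>2 \<and> 2*(u*y1 + w*y2) = y1\<^sup>2 + y2\<^sup>2"
    unfolding dist_eq_coords sh u_def[symmetric] w_def[symmetric]
    by (auto simp: power2_eq_square algebra_simps)
  have R: "?R \<longleftrightarrow> D*u = (x1\<^sup>2 + x2\<^sup>2)*y2 - (y1\<^sup>2 + y2\<^sup>2)*x2 \<and>
                  D*w = (y1\<^sup>2 + y2\<^sup>2)*x1 - (x1\<^sup>2 + x2\<^sup>2)*y1"
    using \<open>D \<noteq> 0\<close> unfolding D_def[symmetric]
    by (auto simp: vec_eq_iff forall_2 circ_num_def vector_2 u_def w_def x1_def x2_def y1_def y2_def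
        field_simps)
  show ?thesis unfolding L R
  proof
    assume "2*(u*x1 + w*x2) = x1\<^sup>2 + x2\<^sup>2 \<and> 2*(u*y1 + w*y2) = y1\<^sup>2 + y2\<^sup>2"
    then show "D*u = (x1\<^sup>2 + x2\<^sup>2)*y2 - (y1\<^sup>2 + y2\<^sup>2)*x2 \<and>
               D*w = (y1\<^sup>2 + y2\<^sup>2)*x1 - (x1\<^sup>2 + x2\<^sup>2)*y1"
      unfolding D by algebra
  next
    assume h: "D*u = (x1\<^sup>2 + x2\<^sup>2)*y2 - (y1\<^sup>2 + y2\<^sup>2)*x2 \<and>
               D*w = (y1\<^sup>2 + y2\<^sup>2)*x1 - (x1\<^sup>2 + x2\<^sup>2)*y1"
    have "D * (2*(u*x1 + w*x2)) = D * (x1\<^sup>2 + x2\<^sup>2)"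
      using h D by algebra
    moreover have "D * (2*(u*y1 + w*y2)) = D * (y1\<^sup>2 + y2\<^sup>2)"
      using h D by algebra
    ultimately show "2*(u*x1 + w*x2) = x1\<^sup>2 + x2\<^sup>2 \<and> 2*(u*y1 + w*y2) = y1\<^sup>2 + y2\<^sup>2"
      using \<open>D \<noteq> 0\<close> by simp
  qed
qed

lemma circumcenter_unique:
  assumes "tri_area a b c \<noteq> 0"
  shows "\<exists>!p. dist p a = dist p b \<and> dist p a = dist p c"
  unfolding equidistant_iff[OF assms] by simp

lemma circumcenter_eq:
  assumes "tri_area a b c \<noteq> 0"
  shows "circumcenter a b c = a + (1 / (4 * tri_area a b c)) *\<^sub>R circ_num a b c"
  unfolding circumcenter_def equidistant_iff[OF assms] by simp

lemma off_side_lines_exists: "\<exists>q. off_side_lines P q"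
proof -
  let ?N = "\<Union>i<length P. affine hull {vertex P i, vertex P (Suc i)}"
  have "negligible (affine hull {a, b})" for a b :: "real^2"
  proof -
    have "card {a, b} \<le> DIM(real^2)" by (simp add: card_insert_if)
    then have "interior (affine hull {a, b}) = {}" by (intro empty_interior_affine_hull) auto
    then show ?thesis by (simp add: negligible_convex_interior affine_imp_convex)
  qed
  then have "negligible ?N" by (intro negligible_Union) auto
  then have "?N \<noteq> UNIV" using open_not_negligible[OF open_UNIV] by (metis UNIV_not_empty)
  then show ?thesis unfolding off_side_lines_def by blast
qed

text \<open>
  Passing from apex \<open>0\<close> to apex \<open>q\<close> changes the area-weighted circumcenter of a
  triangle on a side by a difference of two terms belonging to the endpoints of that side.
\<close>

definition shift_term :: "real^2 \<Rightarrow> real^2 \<Rightarrow> real^2" where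
  "shift_term q x = vector
     [2 * q$1 * (x$1 * q$2 - x$2 * q$1) + q$2 * ((x$1)\<^sup>2 + (x$2)\<^sup>2)
        - 2 * q$2 * (x$1 * q$1 + x$2 * q$2) + ((q$1)\<^sup>2 + (q$2)\<^sup>2) * x$2,
      2 * q$2 * (x$1 * q$2 - x$2 * q$1) - q$1 * ((x$1)\<^sup>2 + (x$2)\<^sup>2)
        + 2 * q$1 * (x$1 * q$1 + x$2 * q$2) - ((q$1)\<^sup>2 + (q$2)\<^sup>2) * x$1]"

lemma weighted_circumcenter:
  assumes "tri_area q b c \<noteq> 0"
  shows "tri_area q b c *\<^sub>R circumcenter q b c =
     (1/4) *\<^sub>R (circ_num 0 b c + (shift_term q c - shift_term q b))"
proof -
  have "tri_area q b c *\<^sub>R circumcenter q b c = tri_area q b c *\<^sub>R q + (1/4) *\<^sub>R circ_num q b c"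
    unfolding circumcenter_eq[OF assms] scaleR_add_right using assms by simp
  also have "\<dots> = (1/4) *\<^sub>R (circ_num 0 b c + (shift_term q c - shift_term q b))"
    by (simp add: vec_eq_iff forall_2 circ_num_def shift_term_def vector_2 tri_area_coords
        power2_eq_square field_simps)
  finally show ?thesis .
qed

lemma CCM_from_eq:
  assumes "polygon P" "off_side_lines P q"
  shows "CCM_from q P =
     (1 / (4 * signed_area P)) *\<^sub>R (\<Sum>i<length P. circ_num 0 (vertex P i) (vertex P (Suc i)))"
proof -
  have "P \<noteq> []" using assms(1) by (auto simp: polygon_def)
  have *: "(tri_area q (vertex P i) (vertex P (Suc i)) / signed_area P)
        *\<^sub>R circumcenter q (vertex P i) (vertex P (Suc i)) =
      (1 / (4 * signed_area P)) *\<^sub>R (circ_num 0 (vertex P i) (vertex P (Suc i))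
         + (shift_term q (vertex P (Suc i)) - shift_term q (vertex P i)))"
    if "i < length P" for i
  proof -
    have "tri_area q (vertex P i) (vertex P (Suc i)) \<noteq> 0"
      using assms that by (intro tri_area_nonzero) (auto simp: polygon_def off_side_lines_def)
    from arg_cong[OF weighted_circumcenter[OF this], of "\<lambda>z. (1 / signed_area P) *\<^sub>R z"]
    show ?thesis by simp
  qed
  have "CCM_from q P = (1 / (4 * signed_area P)) *\<^sub>R
     ((\<Sum>i<length P. circ_num 0 (vertex P i) (vertex P (Suc i)))
      + (\<Sum>i<length P. shift_term q (vertex P (Suc i)) - shift_term q (vertex P i)))"
    unfolding CCM_from_def by (simp add: * scaleR_sum_right flip: sum.distrib scaleR_add_right)
  then show ?thesis using sum_cyclic[OF \<open>P \<noteq> []\<close>, of "shift_term q"] by simp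
qed

lemma CCM_eq_CCM_from:
  assumes "polygon P" "off_side_lines P q"
  shows "CCM P = CCM_from q P"
  unfolding CCM_def using assms by (intro the_equality) (auto simp: CCM_from_eq)

lemma CM_eq_centroids:
  assumes "polygon P"
  shows "CM P =
     (\<Sum>i<length P. (tri_area q (vertex P i) (vertex P (Suc i)) / signed_area P)
        *\<^sub>R centroid q (vertex P i) (vertex P (Suc i)))"
proof (cases "signed_area P = 0")
  case True
  then show ?thesis by (simp add: CM_def)
next
  case False
  have "P \<noteq> []" using assms by (auto simp: polygon_def)
  define cr where "cr b c = b$1 * c$2 - c$1 * b$2" for b c :: "real^2"
  define T where "T x = cr x q *\<^sub>R (q + x)" for x
  have *: "(tri_area q b c / signed_area P) *\<^sub>R centroid q b c =
      (1 / (6 * signed_area P)) *\<^sub>R (cr b c *\<^sub>R (b + c) + (T c - T b))" for b c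
    using False
    by (simp add: vec_eq_iff forall_2 centroid_def T_def cr_def tri_area_coords field_simps)
  have "(\<Sum>i<length P. (tri_area q (vertex P i) (vertex P (Suc i)) / signed_area P)
        *\<^sub>R centroid q (vertex P i) (vertex P (Suc i))) =
     (1 / (6 * signed_area P)) *\<^sub>R
     ((\<Sum>i<length P. cr (vertex P i) (vertex P (Suc i)) *\<^sub>R (vertex P i + vertex P (Suc i)))
      + (\<Sum>i<length P. T (vertex P (Suc i)) - T (vertex P i)))"
    by (simp add: * scaleR_sum_right flip: sum.distrib scaleR_add_right)
  also have "\<dots> = CM P"
    using sum_cyclic[OF \<open>P \<noteq> []\<close>, of T]
    by (simp add: CM_def vec_eq_iff forall_2 cr_def mult.commute)
  finally show ?thesis by simp
qed

end

theory Submission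
  imports Defs
begin

text \<open>
  Write \<open>J\<close> for the rotation by a right angle. For a side from \<open>b\<close> to \<open>c\<close>, the difference between
  the area-weighted circumcenter and the area-weighted centroid of the triangle \<open>0, b, c\<close> is,
  up to a constant factor, \<open>(\<bar>c\<bar>\<^sup>2 - l\<^sup>2) J c - (\<bar>b\<bar>\<^sup>2 - l\<^sup>2) J b\<close> with \<open>l = \<bar>c - b\<bar>\<close>. If \<open>l\<close> is the same
  for all sides, these differences telescope around the polygon.
\<close>

text \<open>\<open>s\<close> is the squared side length, kept free of the side so that one function
  serves both ends of every side.\<close>

definition rotated_weight :: "real \<Rightarrow> real^2 \<Rightarrow> real^2" where
  "rotated_weight s x = ((x$1)\<^sup>2 + (x$2)\<^sup>2 - s) *\<^sub>R vector [- (x$2), x$1]"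

text \<open>Scaling by 12 clears the factors 1/4 and 1/6; the resulting polynomial identity also
  covers \<open>b\<close>, \<open>c\<close> collinear with the origin.\<close>

lemma circumcenter_centroid_difference:
  fixes b c :: "real^2"
  shows "3 *\<^sub>R circ_num 0 b c - (2 * (b$1 * c$2 - c$1 * b$2)) *\<^sub>R (b + c) =
    rotated_weight ((dist b c)\<^sup>2) c - rotated_weight ((dist b c)\<^sup>2) b"
proof -
  have d: "(dist b c)\<^sup>2 = (b$1 - c$1)\<^sup>2 + (b$2 - c$2)\<^sup>2"
    by (simp add: dist_vec_def L2_set_def sum_2 dist_real_def)
  show ?thesis
    unfolding d
    by (simp add: vec_eq_iff forall_2 circ_num_def rotated_weight_def vector_2
        power2_eq_square algebra_simps)
qed

lemma sum_circ_num_equilateral: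
  assumes "P \<noteq> []" "equilateral P"
  shows "3 *\<^sub>R (\<Sum>i<length P. circ_num 0 (vertex P i) (vertex P (Suc i))) =
    2 *\<^sub>R (\<Sum>i<length P.
      (vertex P i $ 1 * vertex P (Suc i) $ 2 - vertex P (Suc i) $ 1 * vertex P i $ 2)
        *\<^sub>R (vertex P i + vertex P (Suc i)))" (is "3 *\<^sub>R sum ?C _ = 2 *\<^sub>R sum ?M _")
proof -
  define s where "s = (dist (vertex P 0) (vertex P (Suc 0)))\<^sup>2"
  have "(dist (vertex P i) (vertex P (Suc i)))\<^sup>2 = s" if "i < length P" for i
    using assms that unfolding equilateral_def s_def by (metis length_greater_0_conv)
  then have "3 *\<^sub>R ?C i - 2 *\<^sub>R ?M i =
      rotated_weight s (vertex P (Suc i)) - rotated_weight s (vertex P i)" if "i < length P" for i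
    using circumcenter_centroid_difference[of "vertex P i" "vertex P (Suc i)"] that by simp
  then have "(\<Sum>i<length P. 3 *\<^sub>R ?C i - 2 *\<^sub>R ?M i) =
      (\<Sum>i<length P. rotated_weight s (vertex P (Suc i)) - rotated_weight s (vertex P i))"
    by simp
  also have "\<dots> = 0"
    by (rule sum_cyclic[OF \<open>P \<noteq> []\<close>])
  finally show ?thesis
    by (simp add: sum_subtractf scaleR_sum_right)
qed

theorem theorem2:
  fixes P :: "(real^2) list"
  assumes "polygon P"
    and "signed_area P \<noteq> 0"
    and "equilateral P"
  shows "CCM P = CM P"
proof -
  let ?C = "\<Sum>i<length P. circ_num 0 (vertex P i) (vertex P (Suc i))"
  let ?M = "\<Sum>i<length P.
      (vertex P i $ 1 * vertex P (Suc i) $ 2 - vertex P (Suc i) $ 1 * vertex P i $ 2)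
        *\<^sub>R (vertex P i + vertex P (Suc i))"
  have "P \<noteq> []" using assms(1) by (auto simp: polygon_def)
  obtain q where q: "off_side_lines P q" using off_side_lines_exists by blast
  \<comment> \<open>12 is the common denominator of the 1/4 in \<open>CCM_from_eq\<close> and the
    1/6 in \<open>CM_def\<close>.\<close>
  have "CCM P = (1 / (12 * signed_area P)) *\<^sub>R (3 *\<^sub>R ?C)"
    using CCM_eq_CCM_from[OF assms(1) q] CCM_from_eq[OF assms(1) q] by simp
  also have "\<dots> = (1 / (12 * signed_area P)) *\<^sub>R (2 *\<^sub>R ?M)"
    unfolding sum_circ_num_equilateral[OF \<open>P \<noteq> []\<close> assms(3)] ..
  also have "\<dots> = CM P"
    by (simp add: CM_def vec_eq_iff forall_2 mult.commute)
  finally show ?thesis .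
qed

end
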